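(* Let $x\in\mathbb{R}$ with $x>5$. Then $$P_a(x)\,P_b(x)>P_{a+b}(x)$$ for all positive integers $a$ and $b$.
   Context: Let $\sigma_2(n)=\sum_{d\mid n}d^2$. The polynomials $P_n(x)$ are defined by $P_0(x)=1$ and $P_n(x)=\frac{x}{n}\sum_{k=1}^n\sigma_2(k)\,P_{n-k}(x)$ for $n\geq1$; equivalently $\sum_{n\ge0}P_n(x)q^n=\prod_{n\ge1}(1-q^n)^{-nx}$. *)

theory Defs
  imports Complex_Main "HOL-Computational_Algebra.Polynomial"
begin

(* Only used for positive n: the divisor set of 0 is infinite, so sigma2 0 = 0. *)
definition sigma2 :: "nat \<Rightarrow> nat" where
  "sigma2 n = (\<Sum>d | d dvd n. d\<^sup>2)"

(* The factor [:0, 1:] is the indeterminate x. *)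
function P :: "nat \<Rightarrow> real poly" where
  "P n = (if n = 0 then 1
          else smult (1 / real n) ([:0, 1:] * (\<Sum>k = 1..n. smult (real (sigma2 k)) (P (n - k)))))"
  by auto
termination by (relation "measure id") auto

declare P.simps [simp del]

end

theory Submission
  imports Defs
begin

text \<open>
  Write \<open>n = a + b\<close> with \<open>b \<le> a\<close>, and \<open>s\<close> for the sum of squares of divisors. By induction on \<open>n\<close>,
  expand \<open>P a\<close> in \<open>P a * P b\<close> by the recursion and apply the induction hypothesis to every product
  \<open>P i * P b\<close>. This yields all terms \<open>s (n - i) * P i\<close> of the recursion for \<open>P n\<close> except those with
  \<open>i < b\<close>, so it suffices that these low terms make up less than the fraction \<open>b / n\<close> of the whole sum.
  Applying the recursion once more bounds the whole sum below by a combination of the \<open>P i\<close> whose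
  coefficients are convolutions of squares, of order \<open>(n - i)\<^sup>5 / n\<close>, while \<open>s (n - i)\<close> is at most
  \<open>5/3 (n - i)\<^sup>2\<close>. Thirteen small pairs \<open>(a, b)\<close> escape this estimate; for them the claim follows
  linearly from \<open>j * P j > 5 * (\<Sum>i<j. s (j - i) * P i)\<close>.
\<close>

section \<open>Quadratic bounds for the sum of squares of divisors\<close>

text \<open>The subtracted term carries the induction; 5/3 is the constant that gives equality at
  \<open>n = 1\<close>.\<close>

lemma sum_inverse_squares_le: "(\<Sum>d=1..n. 1 / (real d)\<^sup>2) \<le> 5/3 - 2 / (2 * real n + 1)" if "n \<ge> 1"
  using that
proof (induction n rule: dec_induct)
  case base
  then show ?case by simp
next
  case (step n)
  \<comment> \<open>\<open>1 / d\<^sup>2 \<le> 1 / (d\<^sup>2 - 1/4)\<close>, which telescopes\<close>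
  have "1 / (real n + 1)\<^sup>2 \<le> 2 / (2 * real n + 1) - 2 / (2 * real n + 3)"
    by (simp add: divide_simps power2_eq_square) (simp add: algebra_simps)
  with step show ?case by (simp add: algebra_simps)
qed

text \<open>Replacing each divisor \<open>d\<close> by \<open>n / d\<close> turns the sum into n^2
  times a sum of inverse squares, which is then extended to all \<open>d\<close> up to
  \<open>n\<close>.\<close>

lemma sigma2_le: "real (sigma2 n) \<le> 5/3 * (real n)\<^sup>2"
proof (cases "n = 0")
  case True
  then show ?thesis by (simp add: sigma2_def)
next
  case False
  have "sigma2 n = (\<Sum>d | d dvd n. (n div d)\<^sup>2)"
    unfolding sigma2_def
    by (rule sum.reindex_bij_witness[where i = "\<lambda>d. n div d" and j = "\<lambda>d. n div d"])
      (use False in \<open>auto elim!: dvdE\<close>)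
  also have "real \<dots> = (\<Sum>d | d dvd n. (real n)\<^sup>2 * (1 / (real d)\<^sup>2))"
    by (simp add: real_of_nat_div power_divide)
  also have "\<dots> \<le> (\<Sum>d=1..n. (real n)\<^sup>2 * (1 / (real d)\<^sup>2))"
    using False by (intro sum_mono2) (auto dest: dvd_imp_le intro: Nat.gr0I)
  also have "\<dots> = (real n)\<^sup>2 * (\<Sum>d=1..n. 1 / (real d)\<^sup>2)"
    by (simp add: sum_distrib_left)
  also have "\<dots> \<le> (real n)\<^sup>2 * (5/3)"
  proof (rule mult_left_mono)
    have "0 \<le> 2 / (2 * real n + 1)" by simp
    then show "(\<Sum>d=1..n. 1 / (real d)\<^sup>2) \<le> 5/3"
      using sum_inverse_squares_le[of n] False by linarith
  qed simp
  finally show ?thesis by simp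
qed

lemma sigma2_ge: "n\<^sup>2 \<le> sigma2 n"
proof (cases "n = 0")
  case False
  then show ?thesis
    unfolding sigma2_def by (intro member_le_sum) auto
qed simp

lemma sigma2_eq_sum_atMost: "n > 0 \<Longrightarrow> sigma2 n = (\<Sum>d\<le>n. if d dvd n then d\<^sup>2 else 0)"
  unfolding sigma2_def sum.inter_filter[symmetric, OF finite_atMost]
  by (rule sum.cong) (auto dest: dvd_imp_le)

lemma sigma2_values:
  "sigma2 (Suc 0) = 1" "sigma2 2 = 5" "sigma2 3 = 10" "sigma2 4 = 21"
  "sigma2 5 = 26" "sigma2 6 = 50" "sigma2 7 = 50" "sigma2 8 = 85"
  by (simp_all add: sigma2_eq_sum_atMost atMost_nat_numeral atMost_Suc)

lemma sum_squares_convolution: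
  "(\<Sum>j\<in>{i<..<n}. (real (n - j))\<^sup>2 * (real (j - i))\<^sup>2) = (real (n - i) ^ 5 - real (n - i)) / 30"
proof (cases "i < n")
  case True
  \<comment> \<open>The induction needs the upper limit \<open>m\<close> decoupled from
    \<open>N\<close>; the three summands are the power sums of k^2, k^3 and k^4 from expanding the
    square.\<close>
  have partial: "(\<Sum>k<m. (N - real k)\<^sup>2 * (real k)\<^sup>2) =
      N\<^sup>2 * (m * (real m - 1) * (2 * real m - 1) / 6) - 2 * N * (m * (real m - 1) / 2)\<^sup>2 +
      m * (real m - 1) * (2 * real m - 1) * (3 * (real m)\<^sup>2 - 3 * real m - 1) / 30" for m N
    by (induction m) (simp_all add: field_simps power2_eq_square)
  have "(\<Sum>j\<in>{i<..<n}. (real (n - j))\<^sup>2 * (real (j - i))\<^sup>2) =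
      (\<Sum>k\<in>{0<..<n - i}. (real (n - i) - real k)\<^sup>2 * (real k)\<^sup>2)"
    by (rule sum.reindex_bij_witness[where i = "\<lambda>k. k + i" and j = "\<lambda>j. j - i"])
      (auto simp: of_nat_diff)
  also have "\<dots> = (\<Sum>k<n - i. (real (n - i) - real k)\<^sup>2 * (real k)\<^sup>2)"
    by (rule sum.mono_neutral_left) auto
  also have "\<dots> = (real (n - i) ^ 5 - real (n - i)) / 30"
    unfolding partial by (simp add: field_simps power2_eq_square eval_nat_numeral)
  finally show ?thesis .
qed simp

section \<open>Recursion and lower bounds at a real argument\<close>

lemma poly_P_0 [simp]: "poly (P 0) x = 1"
  by (simp add: P.simps)

lemma poly_P_rec:
  "real n * poly (P n) x = x * (\<Sum>i<n. real (sigma2 (n - i)) * poly (P i) x)"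
proof (cases "n = 0")
  case False
  have "(\<Sum>k=1..n. real (sigma2 k) * poly (P (n - k)) x) =
      (\<Sum>i<n. real (sigma2 (n - i)) * poly (P i) x)"
    by (rule sum.reindex_bij_witness[where i = "\<lambda>i. n - i" and j = "\<lambda>k. n - k"]) auto
  then show ?thesis
    using False by (subst P.simps) (simp add: poly_sum)
qed simp

lemma poly_P_pos: "x > 0 \<Longrightarrow> poly (P n) x > 0"
proof (induction n rule: less_induct)
  case (less n)
  show ?case
  proof (cases "n = 0")
    case False
    have "real (sigma2 k) > 0" if "k > 0" for k
      using sigma2_ge[of k] that by (metis of_nat_0_less_iff order_less_le_trans zero_less_power)
    then have "(\<Sum>i<n. real (sigma2 (n - i)) * poly (P i) x) > 0"
      using False less by (intro sum_pos) auto
    then have "real n * poly (P n) x > 0"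
      unfolding poly_P_rec using less.prems by simp
    then show ?thesis using False by (simp add: zero_less_mult_iff)
  qed simp
qed

text \<open>Only here does \<open>x > 5\<close> enter beyond positivity of \<open>x\<close>.\<close>

lemma poly_P_lower:
  assumes "x > 5" "n > 0"
  shows "5 * (\<Sum>i<n. real (sigma2 (n - i)) * poly (P i) x) < real n * poly (P n) x"
proof -
  have "real n * poly (P n) x > 0" using assms poly_P_pos[of x n] by simp
  then have "(\<Sum>i<n. real (sigma2 (n - i)) * poly (P i) x) > 0"
    unfolding poly_P_rec using assms by (simp add: zero_less_mult_iff)
  then show ?thesis unfolding poly_P_rec using assms by simp
qed

text \<open>By \<open>low\<close>, passing from \<open>a + b\<close> to \<open>a\<close> copies of
  \<open>P (a + b)\<close> removes more than the terms with index below \<open>b\<close>. The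
  remaining terms, shifted by \<open>b\<close>, carry the weights of the recursion for
  \<open>P a\<close>.\<close>

lemma poly_P_prod_gt_step:
  assumes "x > 0" "a > 0"
    and IH: "\<And>i. 0 < i \<Longrightarrow> i < a \<Longrightarrow> poly (P (i + b)) x \<le> poly (P i) x * poly (P b) x"
    and low: "real (a + b) * (\<Sum>i<b. real (sigma2 (a + b - i)) * poly (P i) x) <
      real b * (\<Sum>i<a + b. real (sigma2 (a + b - i)) * poly (P i) x)"
  shows "poly (P (a + b)) x < poly (P a) x * poly (P b) x"
proof -
  let ?f = "\<lambda>i. real (sigma2 (a + b - i)) * poly (P i) x"
  let ?n = "real (a + b)"
  have n: "?n > 0" using assms by simp
  have "?n * (x * (\<Sum>i<b. ?f i)) < ?n * (real b * poly (P (a + b)) x)"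
  proof -
    have "?n * (x * (\<Sum>i<b. ?f i)) < x * (real b * (\<Sum>i<a + b. ?f i))"
      using mult_strict_left_mono[OF low \<open>x > 0\<close>] by (simp only: mult_ac)
    also have "\<dots> = real b * (?n * poly (P (a + b)) x)"
      unfolding poly_P_rec by (simp only: mult_ac)
    finally show ?thesis by (simp only: mult_ac)
  qed
  then have defect: "x * (\<Sum>i<b. ?f i) < real b * poly (P (a + b)) x"
    using n by (simp only: mult_less_cancel_left_pos)
  have split: "(\<Sum>i<m + b. g i) = (\<Sum>i<b. g i) + (\<Sum>i<m. g (i + b))"
    for m and g :: "nat \<Rightarrow> real"
    by (induction m) (simp_all add: add_ac)
  have "real a * poly (P (a + b)) x = x * (\<Sum>i<a + b. ?f i) - real b * poly (P (a + b)) x"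
    using poly_P_rec[of "a + b" x] by (simp add: algebra_simps)
  also have "\<dots> < x * (\<Sum>i<a. ?f (i + b))"
    using defect unfolding split by (simp add: algebra_simps)
  also have "\<dots> \<le> x * (\<Sum>i<a. real (sigma2 (a - i)) * (poly (P i) x * poly (P b) x))"
  proof (intro mult_left_mono sum_mono)
    fix i assume "i \<in> {..<a}"
    \<comment> \<open>For \<open>i = 0\<close> both sides are equal; strictness comes from
      \<open>defect\<close> alone.\<close>
    then have "poly (P (i + b)) x \<le> poly (P i) x * poly (P b) x"
      using IH[of i] by (cases "i = 0") auto
    then show "?f (i + b) \<le> real (sigma2 (a - i)) * (poly (P i) x * poly (P b) x)"
      by (simp add: mult_left_mono)
  qed (use \<open>x > 0\<close> in simp)
  also have "\<dots> = real a * poly (P a) x * poly (P b) x"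
    unfolding poly_P_rec by (simp add: sum_distrib_left sum_distrib_right mult_ac)
  finally show ?thesis using \<open>a > 0\<close> by (simp add: mult.assoc)
qed

text \<open>Each \<open>P j\<close> on the right is bounded below by \<open>poly_P_lower\<close>,
  with squares in place of \<open>sigma2\<close> and \<open>j\<close> at most \<open>n - 1\<close>.
  Exchanging the sums produces the convolution of squares; the factor 6 is 30 / 5.\<close>

lemma poly_P_two_step_lower:
  assumes "x > 5"
  shows "(\<Sum>i<n. (real (n - i) ^ 5 - real (n - i)) * poly (P i) x) \<le>
    6 * (real n - 1) * (\<Sum>j<n. real (sigma2 (n - j)) * poly (P j) x)"
proof -
  let ?p = "\<lambda>i. poly (P i) x"
  have sq: "(real k)\<^sup>2 \<le> real (sigma2 k)" for k
    using sigma2_ge[of k] by (metis of_nat_le_iff of_nat_power)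
  have p: "?p i > 0" for i using poly_P_pos assms by simp
  have "(\<Sum>i<n. (real (n - i) ^ 5 - real (n - i)) * ?p i) =
      30 * (\<Sum>i<n. \<Sum>j\<in>{i<..<n}. (real (n - j))\<^sup>2 * (real (j - i))\<^sup>2 * ?p i)"
    unfolding sum_distrib_right[symmetric] sum_squares_convolution by (simp add: sum_distrib_left)
  also have "(\<Sum>i<n. \<Sum>j\<in>{i<..<n}. (real (n - j))\<^sup>2 * (real (j - i))\<^sup>2 * ?p i) =
      (\<Sum>j<n. \<Sum>i<j. (real (n - j))\<^sup>2 * (real (j - i))\<^sup>2 * ?p i)" (is "_ = ?S")
    unfolding sum.Sigma[OF finite_lessThan ballI[OF finite_greaterThanLessThan]]
      sum.Sigma[OF finite_lessThan ballI[OF finite_lessThan]]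
    by (rule sum.reindex_bij_witness[where i = "\<lambda>(i, j). (j, i)" and j = "\<lambda>(i, j). (j, i)"]) auto
  finally have eq: "(\<Sum>i<n. (real (n - i) ^ 5 - real (n - i)) * ?p i) = 30 * ?S" .
  have "5 * ?S \<le> (real n - 1) * (\<Sum>j<n. real (sigma2 (n - j)) * ?p j)"
    unfolding sum_distrib_left
  proof (rule sum_mono)
    fix j assume j: "j \<in> {..<n}"
    have "5 * (\<Sum>i<j. (real (j - i))\<^sup>2 * ?p i) \<le> 5 * (\<Sum>i<j. real (sigma2 (j - i)) * ?p i)"
      by (intro mult_left_mono sum_mono mult_right_mono sq less_imp_le[OF p]) simp
    also have "\<dots> \<le> real j * ?p j"
      using poly_P_lower[OF assms, of j] by (cases "j = 0") auto
    also have "\<dots> \<le> (real n - 1) * ?p j"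
      using p[of j] j by (intro mult_right_mono) auto
    finally have *: "5 * (\<Sum>i<j. (real (j - i))\<^sup>2 * ?p i) \<le> (real n - 1) * ?p j" .
    have "(real (n - j))\<^sup>2 * (5 * (\<Sum>i<j. (real (j - i))\<^sup>2 * ?p i)) \<le>
        real (sigma2 (n - j)) * ((real n - 1) * ?p j)"
      by (rule mult_mono[OF sq *]) (auto intro!: sum_nonneg mult_nonneg_nonneg less_imp_le[OF p])
    then show "(\<Sum>i<j. 5 * ((real (n - j))\<^sup>2 * (real (j - i))\<^sup>2 * ?p i)) \<le>
        (real n - 1) * (real (sigma2 (n - j)) * ?p j)"
      by (simp add: sum_distrib_left mult_ac)
  qed
  then show ?thesis unfolding eq by linarith
qed

section \<open>Smallness of the low terms\<close>

text \<open>This is the comparison of coefficients at index \<open>i\<close> with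
  \<open>N = n - i\<close>, after cancelling a factor \<open>N\<close>.\<close>

lemma quartic_bound:
  fixes N b :: real
  assumes "b = 1 \<and> N \<ge> 9 \<or> 2 \<le> b \<and> b + 1 \<le> N \<and> N \<ge> 6"
  shows "10 * N * ((N + b - 1) * (N + b - 2)) < b * (N ^ 4 - 1)"
  using assms
proof
  assume "b = 1 \<and> N \<ge> 9"
  \<comment> \<open>Expanded in \<open>t\<close>, the difference of the two sides has only positive
    coefficients; the shift by 6 below serves the same purpose.\<close>
  then obtain t where "b = 1" "N = 9 + t" "t \<ge> 0" by (metis add.commute diff_add_cancel diff_ge_0_iff_ge)
  moreover have "t * t \<ge> 0" "t * (t * t) \<ge> 0" "t * (t * (t * t)) \<ge> 0"
    using \<open>t \<ge> 0\<close> by simp_all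
  ultimately show ?thesis
    by (simp add: algebra_simps power4_eq_xxxx; linarith)
next
  assume *: "2 \<le> b \<and> b + 1 \<le> N \<and> N \<ge> 6"
  define f where "f b = b * (N ^ 4 - 1) - 10 * N * ((N + b - 1) * (N + b - 2))" for b
  obtain t where t: "N = 6 + t" "t \<ge> 0" using * by (metis add.commute diff_add_cancel diff_ge_0_iff_ge)
  have pow: "t * t \<ge> 0" "t * (t * t) \<ge> 0" "t * (t * (t * t)) \<ge> 0" "t * (t * (t * (t * t))) \<ge> 0"
    using t by simp_all
  have f2: "f 2 > 0" unfolding f_def t
    using t pow by (simp add: algebra_simps power4_eq_xxxx; linarith)
  have fN: "f (N - 1) > 0" unfolding f_def t
    using t pow by (simp add: algebra_simps power4_eq_xxxx; linarith)
  \<comment> \<open>\<open>f\<close> is concave, so it suffices that it is positive at the end points \<open>2\<close> and \<open>N - 1\<close>\<close>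
  have "(N - 3) * f b = (N - 1 - b) * f 2 + (b - 2) * f (N - 1) + 10 * N * (N - 3) * ((b - 2) * (N - 1 - b))"
    unfolding f_def by algebra
  moreover have "(N - 1 - b) * f 2 + (b - 2) * f (N - 1) > 0"
    using * f2 fN by (cases "b = 2") (auto intro: add_nonneg_pos)
  moreover have "10 * N * (N - 3) * ((b - 2) * (N - 1 - b)) \<ge> 0"
    using * by (intro mult_nonneg_nonneg) auto
  ultimately have "(N - 3) * f b > 0" by linarith
  then show ?thesis using * by (simp add: zero_less_mult_iff f_def)
qed

lemma low_terms_large:
  assumes "x > 5" "0 < b" "b \<le> a" and large: "b = 1 \<and> 8 \<le> a \<or> 2 \<le> b \<and> 5 \<le> a"
  shows "real (a + b) * (\<Sum>i<b. real (sigma2 (a + b - i)) * poly (P i) x) <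
      real b * (\<Sum>i<a + b. real (sigma2 (a + b - i)) * poly (P i) x)"
proof -
  let ?p = "\<lambda>i. poly (P i) x"
  define n where "n = a + b"
  have p: "?p i > 0" for i using poly_P_pos assms by simp
  have n: "real n - 1 > 0" using assms unfolding n_def by auto
  \<comment> \<open>The factor from the two-step bound is put in front, so that coefficients can be
    compared index by index.\<close>
  have "(6 * (real n - 1)) * (real n * (\<Sum>i<b. real (sigma2 (n - i)) * ?p i)) =
      (\<Sum>i<b. (6 * real n * (real n - 1)) * real (sigma2 (n - i)) * ?p i)"
    by (simp add: sum_distrib_left mult_ac)
  also have "\<dots> < (\<Sum>i<b. real b * (real (n - i) ^ 5 - real (n - i)) * ?p i)"
  proof (rule sum_strict_mono)
    fix i assume i: "i \<in> {..<b}"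
    define N where "N = real (n - i)"
    \<comment> \<open>The bound \<open>a + 1\<close> turns the thresholds 8 and 5 for
      \<open>a\<close> into 9 and 6 for \<open>N\<close>.\<close>
    have N: "real n \<le> N + real b - 1" "N \<ge> real a + 1" "N > 0"
      using i assms unfolding N_def n_def by auto
    have "(6 * real n * (real n - 1)) * real (sigma2 (n - i)) \<le> (6 * real n * (real n - 1)) * (5/3 * N\<^sup>2)"
      unfolding N_def using n by (intro mult_left_mono sigma2_le) auto
    also have "\<dots> = 10 * N\<^sup>2 * (real n * (real n - 1))" by simp
    also have "\<dots> \<le> 10 * N\<^sup>2 * ((N + real b - 1) * (N + real b - 2))"
      using N n by (intro mult_left_mono mult_mono) auto
    also have "\<dots> = N * (10 * N * ((N + real b - 1) * (N + real b - 2)))"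
      by (simp add: power2_eq_square)
    also have "\<dots> < N * (real b * (N ^ 4 - 1))"
      using large assms N by (intro mult_strict_left_mono quartic_bound) auto
    also have "\<dots> = real b * (N ^ 5 - N)"
      by (simp add: algebra_simps eval_nat_numeral)
    finally show "(6 * real n * (real n - 1)) * real (sigma2 (n - i)) * ?p i <
        real b * (real (n - i) ^ 5 - real (n - i)) * ?p i"
      using p[of i] by (simp add: N_def)
  qed (use assms in auto)
  \<comment> \<open>The low indices alone already suffice; the other terms are nonnegative and are
    merely added.\<close>
  also have "\<dots> \<le> (\<Sum>i<n. real b * (real (n - i) ^ 5 - real (n - i)) * ?p i)"
  proof (rule sum_mono2)
    fix i assume "i \<in> {..<n} - {..<b}"
    then have "real (n - i) ^ 1 \<le> real (n - i) ^ 5"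
      by (intro power_increasing) auto
    then show "0 \<le> real b * (real (n - i) ^ 5 - real (n - i)) * ?p i"
      using p[of i] by simp
  qed (auto simp: n_def)
  also have "\<dots> = real b * (\<Sum>i<n. (real (n - i) ^ 5 - real (n - i)) * ?p i)"
    by (simp add: sum_distrib_left mult_ac)
  also have "\<dots> \<le> real b * (6 * (real n - 1) * (\<Sum>i<n. real (sigma2 (n - i)) * ?p i))"
    using poly_P_two_step_lower[OF \<open>x > 5\<close>] by (intro mult_left_mono) auto
  also have "\<dots> = (6 * (real n - 1)) * (real b * (\<Sum>i<n. real (sigma2 (n - i)) * ?p i))"
    by simp
  finally show ?thesis
    using n mult_less_cancel_left_pos[of "6 * (real n - 1)"] unfolding n_def by simp
qed

lemma low_terms_small:
  assumes "x > 5" "0 < b" "b \<le> a" and "b = 1 \<and> a < 8 \<or> a < 5"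
  shows "real (a + b) * (\<Sum>i<b. real (sigma2 (a + b - i)) * poly (P i) x) <
      real b * (\<Sum>i<a + b. real (sigma2 (a + b - i)) * poly (P i) x)"
proof -
  note lower = poly_P_lower[OF \<open>x > 5\<close>]
  \<comment> \<open>In all remaining pairs \<open>a + b\<close> is at most 8, so no
    \<open>P j\<close> beyond \<open>P 7\<close> occurs.\<close>
  note bounds = lower[of 1] lower[of 2] lower[of 3] lower[of 4] lower[of 5] lower[of 6] lower[of 7]
  have "(a, b) \<in> {(1,1), (2,1), (3,1), (4,1), (5,1), (6,1), (7,1),
      (2,2), (3,2), (4,2), (3,3), (4,3), (4,4)}"
    using assms(2-) by (simp; presburger)
  then show ?thesis
    using bounds
    by (auto simp: lessThan_nat_numeral lessThan_Suc sigma2_values simp flip: numeral_2_eq_2)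
qed

section \<open>Induction on the sum of the indices\<close>

lemma poly_P_prod_gt:
  assumes "x > 5" "0 < b" "b \<le> a"
  shows "poly (P (a + b)) x < poly (P a) x * poly (P b) x"
  using assms(2-)
proof (induction "a + b" arbitrary: a b rule: less_induct)
  case less
  show ?case
  proof (rule poly_P_prod_gt_step)
    fix i assume "0 < i" "i < a"
    \<comment> \<open>Since \<open>i\<close> may be smaller than \<open>b\<close>, the induction
      hypothesis is taken with the larger index first.\<close>
    then show "poly (P (i + b)) x \<le> poly (P i) x * poly (P b) x"
      using less.hyps[of i b] less.hyps[of b i] less.prems
      by (cases "b \<le> i") (auto simp: add.commute mult.commute)
  next
    consider "b = 1 \<and> a < 8 \<or> a < 5" | "b = 1 \<and> 8 \<le> a \<or> 2 \<le> b \<and> 5 \<le> a"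
      using less.prems by linarith
    then show "real (a + b) * (\<Sum>i<b. real (sigma2 (a + b - i)) * poly (P i) x) <
        real b * (\<Sum>i<a + b. real (sigma2 (a + b - i)) * poly (P i) x)"
      using low_terms_small low_terms_large assms(1) less.prems by cases auto
  qed (use assms(1) less.prems in auto)
qed

theorem theorem1p3:
  fixes x :: real and a b :: nat
  assumes "x > 5" and "a > 0" and "b > 0"
  shows "poly (P a) x * poly (P b) x > poly (P (a + b)) x"
  using poly_P_prod_gt[of x b a] poly_P_prod_gt[of x a b] assms
  by (cases "b \<le> a") (auto simp: add.commute mult.commute)

end
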